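(* Let $A \in \mathbf{R}^{m\times N}$, $y\in\mathbf{R}^m$, $\lambda>0$, $\mu>0$. Let $\{x^{(n)}\}_{n\ge 0}\subset \mathbf{R}^N$ be a sequence generated by the half algorithm, i.e. $x^{(n+1)} = H_{\lambda\mu,\frac12}\big(x^{(n)}-\mu A^T(Ax^{(n)}-y)\big)$ for all $n\ge 0$, and assume that it converges to $x^*\in\mathbf{R}^N$. Let $I=\mathrm{supp}(x^* )$. If $$\sigma_{\min}(A_I^TA_I)>\frac{\|A\|_2^2}{4}\qquad\text{and}\qquad \frac{1}{4\sigma_{\min}(A_I^TA_I)}<\mu<\frac{1}{\|A\|_2^2},$$ then $x^*$ is a local minimizer of $T_\lambda$.
   Context: $T_\lambda(x)=\|Ax-y\|_2^2+\lambda\|x\|_{1/2}^{1/2}$, where $\|x\|_{1/2}^{1/2}=\sum_{i=1}^N|x_i|^{1/2}$. $\|A\|_2$ is the spectral norm and $A^T$ the transpose of $A$. Half thresholding operator: for $z\in\mathbf{R}^N$, $H_{\lambda\mu,\frac12}(z)=(h_{\lambda\mu,\frac12}(z_1),\dots,h_{\lambda\mu,\frac12}(z_N))^T$, where for $u\in\mathbf{R}$, $h_{\lambda\mu,\frac12}(u)=f_{\lambda\mu,\frac12}(u)$ if $|u|>\frac{\sqrt[3]{54}}{4}(\lambda\mu)^{2/3}$ and $h_{\lambda\mu,\frac12}(u)=0$ otherwise, with $$f_{\lambda\mu,\frac12}(u)=\tfrac23 u\Big(1+\cos\big(\tfrac{2\pi}{3}-\tfrac23\phi_{\lambda\mu}(u)\big)\Big),\qquad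 \phi_{\lambda\mu}(u)=\arccos\Big(\tfrac{\lambda\mu}{8}\big(\tfrac{|u|}{3}\big)^{-3/2}\Big).$$ The initial point $x^{(0)}\in\mathbf{R}^N$ is arbitrary. $\mathrm{supp}(x)=\{i: x_i\ne 0\}$. For an index set $S$, $A_S$ is the submatrix of $A$ consisting of the columns indexed by $S$, and $\sigma_{\min}(A_S^TA_S)$ is the minimal singular value of $A_S^TA_S$ (its use presupposes that $S$ is nonempty). *)

theory Defs
  imports "HOL-Analysis.Analysis"
begin

definition supp :: "real ^ 'n \<Rightarrow> 'n set" where
  "supp x = {i. x $ i \<noteq> 0}"

definition T_half :: "real ^ 'n ^ 'm \<Rightarrow> real ^ 'm \<Rightarrow> real \<Rightarrow> real ^ 'n \<Rightarrow> real" where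
  "T_half A y lam x = (norm (A *v x - y))\<^sup>2 + lam * (\<Sum>i\<in>UNIV. \<bar>x $ i\<bar> powr (1/2))"

text \<open>In the thresholding functions, \<open>c\<close> stands for the product of the regularization
  parameter and the step size.\<close>

definition half_phi :: "real \<Rightarrow> real \<Rightarrow> real" where
  "half_phi c u = arccos (c / 8 * (\<bar>u\<bar> / 3) powr (- 3 / 2))"

definition half_f :: "real \<Rightarrow> real \<Rightarrow> real" where
  "half_f c u = 2 / 3 * u * (1 + cos (2 * pi / 3 - 2 / 3 * half_phi c u))"

definition half_h :: "real \<Rightarrow> real \<Rightarrow> real" where
  "half_h c u = (if \<bar>u\<bar> > root 3 54 / 4 * c powr (2 / 3) then half_f c u else 0)"

definition half_H :: "real \<Rightarrow> real ^ 'n \<Rightarrow> real ^ 'n" where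
  "half_H c z = (\<chi> i. half_h c (z $ i))"

definition spectral_norm :: "real ^ 'n ^ 'm \<Rightarrow> real" where
  "spectral_norm A = onorm (\<lambda>x. A *v x)"

text \<open>The size of a column submatrix depends on the index set, so such matrices are functions of a
  row and a column index, together with explicit finite index sets: only entries with indices in
  these sets belong to the matrix, and vectors are likewise read on the index set only.\<close>

definition imat_transpose :: "('a \<Rightarrow> 'b \<Rightarrow> real) \<Rightarrow> 'b \<Rightarrow> 'a \<Rightarrow> real" where
  "imat_transpose M = (\<lambda>i j. M j i)"

definition imat_mult ::
    "'k set \<Rightarrow> ('a \<Rightarrow> 'k \<Rightarrow> real) \<Rightarrow> ('k \<Rightarrow> 'b \<Rightarrow> real) \<Rightarrow> 'a \<Rightarrow> 'b \<Rightarrow> real" where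
  "imat_mult K M P = (\<lambda>i j. \<Sum>k\<in>K. M i k * P k j)"

definition imat_eigenvalue :: "'a set \<Rightarrow> ('a \<Rightarrow> 'a \<Rightarrow> real) \<Rightarrow> real \<Rightarrow> bool" where
  "imat_eigenvalue S M e \<longleftrightarrow>
     (\<exists>v. (\<exists>i\<in>S. v i \<noteq> 0) \<and> (\<forall>i\<in>S. (\<Sum>j\<in>S. M i j * v j) = e * v i))"

definition imat_singular_values :: "'a set \<Rightarrow> ('a \<Rightarrow> 'a \<Rightarrow> real) \<Rightarrow> real set" where
  "imat_singular_values S M = {sqrt e |e. imat_eigenvalue S (imat_mult S (imat_transpose M) M) e}"

text \<open>Meaningful for finite nonempty \<open>S\<close> only.\<close>

definition sigma_min :: "'a set \<Rightarrow> ('a \<Rightarrow> 'a \<Rightarrow> real) \<Rightarrow> real" where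
  "sigma_min S M = Min (imat_singular_values S M)"

definition column_submatrix :: "real ^ 'n ^ 'm \<Rightarrow> 'n set \<Rightarrow> 'm \<Rightarrow> 'n \<Rightarrow> real" where
  "column_submatrix A S = (\<lambda>k j. if j \<in> S then A $ k $ j else 0)"

definition gram_submatrix :: "real ^ 'n ^ 'm \<Rightarrow> 'n set \<Rightarrow> 'n \<Rightarrow> 'n \<Rightarrow> real" where
  "gram_submatrix A S =
     imat_mult UNIV (imat_transpose (column_submatrix A S)) (column_submatrix A S)"

definition local_minimizer :: "('a::metric_space \<Rightarrow> real) \<Rightarrow> 'a \<Rightarrow> bool" where
  "local_minimizer f x \<longleftrightarrow> (\<exists>r>0. \<forall>z\<in>ball x r. f x \<le> f z)"

end

theory Submission
  imports Defs
begin

text \<open>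
  With \<open>u = 3 * s\<^sup>2\<close> the nonzero values of the thresholding function are \<open>v = (2 * s * cos q)\<^sup>2\<close> up to
  sign, so the triple angle formula shows that they solve \<open>v + c / 4 * sgn v / sqrt \<bar>v\<bar> = u\<close>, and
  the threshold gives \<open>\<bar>v\<bar> ^ 3 \<ge> c\<^sup>2 / 4\<close>, where \<open>c = lam * mu\<close>. Both facts survive the limit. Hence
  \<open>xs\<close> is a stationary point of the objective restricted to its support, and the Hessian of this
  restriction is at least \<open>2 * \<sigma> - lam / 4 * (2 / c) = 2 * \<sigma> - 1 / (2 * mu) > 0\<close>, where \<open>\<sigma>\<close> is the
  minimal singular value in the hypothesis, i.e. the minimum of the Rayleigh quotient of the Gram
  matrix. Off the support the square root dominates every linear term.
\<close>

section \<open>Algebra of the thresholding function and its limits\<close>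

lemma half_f_minus: "half_f c (- u) = - half_f c u"
  by (simp add: half_f_def half_phi_def)

text \<open>\<open>sqrt (half_f c u)\<close> is a trigonometric root of the cubic
  \<open>r ^ 3 - u * r + c / 4 = 0\<close>. The threshold keeps the angle \<open>q\<close> below
  \<open>pi / 4\<close>, which bounds this root from below.\<close>

lemma half_f_pos_props:
  assumes c: "c > 0" and u: "u > root 3 54 / 4 * c powr (2 / 3)"
  shows "half_f c u > 0" "half_f c u ^ 3 \<ge> c\<^sup>2 / 4"
    "half_f c u + c / 4 / sqrt (half_f c u) = u"
proof -
  define t where "t = root 3 54 / 4 * c powr (2 / 3)"
  have t0: "t > 0" using c by (simp add: t_def)
  have "(c powr (2/3)) ^ 3 = c\<^sup>2"
    using c by (simp add: powr_power)
  then have t3: "t ^ 3 = 27 / 32 * c\<^sup>2"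
    by (simp add: t_def power_mult_distrib power_divide odd_real_root_pow)
  have u0: "u > 0" and ut: "u > t" using u t0 by (auto simp: t_def)
  define s where "s = sqrt (u / 3)"
  have s0: "s > 0" using u0 by (simp add: s_def)
  have us: "u = 3 * s\<^sup>2" using u0 by (simp add: s_def)
  have pw: "(\<bar>u\<bar> / 3) powr (- 3 / 2) = 1 / s ^ 3"
  proof -
    have "(s\<^sup>2) powr (- 3 / 2) = s powr (-3)"
      using s0 powr_powr [of s 2 "- 3 / 2"] by simp
    also have "\<dots> = 1 / s ^ 3"
      using s0 by (simp add: powr_minus divide_simps)
    finally show ?thesis using s0 by (simp add: us)
  qed
  define w where "w = c / 8 / s ^ 3"
  \<comment> \<open>Since \<open>u ^ 3 = 27 * s ^ 6\<close>, the cubed threshold condition is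
    exactly \<open>w\<^sup>2 < 1 / 2\<close>.\<close>
  have "u ^ 3 > 27 / 32 * c\<^sup>2"
    using power_strict_mono [OF ut, of 3] t0 t3 by simp
  then have "c\<^sup>2 < 32 * (s ^ 3)\<^sup>2"
    by (simp add: us power_mult_distrib flip: power_mult)
  then have w2: "w\<^sup>2 < 1 / 2"
    using s0 by (simp add: w_def power_divide divide_simps)
  have w0: "w > 0" using c s0 by (simp add: w_def)
  have ws: "w < cos (pi / 4)"
    by (rule power2_less_imp_less) (use w2 in \<open>auto simp: cos_45 power_divide\<close>)
  then have w1: "w < 1" using cos_le_one [of "pi/4"] by linarith
  define p where "p = half_phi c u"
  have p: "p = arccos w" unfolding p_def half_phi_def pw w_def by simp
  have cosp: "cos p = w" using w0 w1 by (simp add: p)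
  have p_le: "p \<le> pi / 2" using w0 w1 arccos_le_pi2 [of w] by (simp add: p)
  have p_ge: "p > pi / 4"
  proof (rule ccontr)
    assume "\<not> ?thesis"
    moreover have "0 \<le> p" using w0 w1 by (simp add: p arccos_lbound)
    ultimately have "cos (pi / 4) \<le> cos p" by (intro cos_monotone_0_pi_le) auto
    then show False using ws cosp by simp
  qed
  \<comment> \<open>Half the argument of the cosine in \<open>half_f\<close>, so that
    \<open>1 + cos (2 * q)\<close> is twice a square; also \<open>3 * q = pi - p\<close>, which
    prepares the triple angle formula.\<close>
  define q where "q = pi / 3 - p / 3"
  have q: "q < pi / 4" "q > 0" using p_ge p_le by (auto simp: q_def)
  have cq: "cos q > cos (pi / 4)" using q by (intro cos_monotone_0_pi) auto
  have cq0: "cos q > 0" using q by (intro cos_gt_zero) auto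
  have cq2: "(cos q)\<^sup>2 > 1 / 2"
    using power_strict_mono [OF cq, of 2] by (simp add: cos_45 power_divide)
  have f: "half_f c u = (2 * s * cos q)\<^sup>2"
  proof -
    have "half_f c u = 2 / 3 * u * (1 + cos (2 * q))"
      by (simp add: half_f_def q_def p_def algebra_simps)
    then show ?thesis
      by (simp add: cos_double_cos us power2_eq_square)
  qed
  have sq: "sqrt (half_f c u) = 2 * s * cos q"
    using s0 cq0 by (simp add: f)
  show f0: "half_f c u > 0" using s0 cq0 by (simp add: f)
  \<comment> \<open>The factor 2/3 comes from \<open>(cos q)\<^sup>2 > 1 / 2\<close>; its cube 8/27
    turns 27/32 into 1/4.\<close>
  have "2 / 3 * t \<le> half_f c u"
  proof -
    have "2 / 3 * t \<le> 2 / 3 * u" using ut by simp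
    also have "\<dots> = 4 * s\<^sup>2 * (1 / 2)" by (simp add: us)
    also have "\<dots> \<le> 4 * s\<^sup>2 * (cos q)\<^sup>2" using cq2 by (intro mult_left_mono) auto
    finally show ?thesis by (simp add: f power_mult_distrib)
  qed
  then have "(2 / 3 * t) ^ 3 \<le> half_f c u ^ 3" using t0 by (intro power_mono) auto
  then show "half_f c u ^ 3 \<ge> c\<^sup>2 / 4" by (simp add: power_mult_distrib t3 power_divide)
  have "cos (3 * q) = - w" by (simp add: q_def cosp [symmetric] algebra_simps)
  then have "4 * cos q ^ 3 - 3 * cos q = - w" by (simp add: cos_treble_cos)
  \<comment> \<open>The factor \<open>2 * s ^ 3\<close> turns the triple angle formula into the
    cubic for \<open>2 * s * cos q\<close>; dividing the cubic by this root gives the claim.\<close>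
  then have "2 * s ^ 3 * (4 * cos q ^ 3 - 3 * cos q) = 2 * s ^ 3 * (- w)" by simp
  also have "\<dots> = - c / 4" using s0 by (simp add: w_def)
  finally have "(2 * s * cos q) ^ 3 - u * (2 * s * cos q) + c / 4 = 0"
    by (simp add: us algebra_simps power2_eq_square power3_eq_cube)
  then show "half_f c u + c / 4 / sqrt (half_f c u) = u"
    unfolding sq unfolding f using s0 cq0
    by (simp add: field_simps power2_eq_square power3_eq_cube)
qed

lemma half_h_nonzero_props:
  assumes c: "c > 0" and nz: "half_h c u \<noteq> 0"
  shows "\<bar>half_h c u\<bar> ^ 3 \<ge> c\<^sup>2 / 4"
    "half_h c u + c / 4 * (sgn (half_h c u) / sqrt \<bar>half_h c u\<bar>) = u"
proof -
  have thr: "\<bar>u\<bar> > root 3 54 / 4 * c powr (2 / 3)" and h: "half_h c u = half_f c u"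
    using nz by (auto simp: half_h_def split: if_splits)
  note P = half_f_pos_props [OF c thr]
  have "\<bar>half_h c u\<bar> ^ 3 \<ge> c\<^sup>2 / 4 \<and>
    half_h c u + c / 4 * (sgn (half_h c u) / sqrt \<bar>half_h c u\<bar>) = u"
  proof (cases "u \<ge> 0")
    case True
    then show ?thesis using P by (simp add: h)
  next
    case False
    then have "half_f c \<bar>u\<bar> = - half_f c u" by (simp add: half_f_minus)
    then show ?thesis using P False by (simp add: h)
  qed
  then show "\<bar>half_h c u\<bar> ^ 3 \<ge> c\<^sup>2 / 4"
    "half_h c u + c / 4 * (sgn (half_h c u) / sqrt \<bar>half_h c u\<bar>) = u" by auto
qed

text \<open>\<open>half_h\<close> jumps at its threshold, so continuity of \<open>half_h\<close>
  cannot be used. But the relations between input and nonzero output are closed, and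
  \<open>a \<noteq> 0\<close> makes the outputs eventually nonzero.\<close>

lemma half_h_limit_props:
  assumes c: "c > 0" and x: "x \<longlonglongrightarrow> a" and u: "u \<longlonglongrightarrow> b"
    and step: "\<And>n. x (Suc n) = half_h c (u n)" and a: "a \<noteq> 0"
  shows "\<bar>a\<bar> ^ 3 \<ge> c\<^sup>2 / 4" "a + c / 4 * (sgn a / sqrt \<bar>a\<bar>) = b"
proof -
  have x': "(\<lambda>n. x (Suc n)) \<longlonglongrightarrow> a" using x by (rule LIMSEQ_Suc)
  then have ev: "\<forall>\<^sub>F n in sequentially. x (Suc n) \<noteq> 0"
    using a by (rule tendsto_imp_eventually_ne)
  show "\<bar>a\<bar> ^ 3 \<ge> c\<^sup>2 / 4"
  proof (rule tendsto_lowerbound)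
    show "(\<lambda>n. \<bar>x (Suc n)\<bar> ^ 3) \<longlonglongrightarrow> \<bar>a\<bar> ^ 3" by (intro tendsto_intros x')
    show "\<forall>\<^sub>F n in sequentially. c\<^sup>2 / 4 \<le> \<bar>x (Suc n)\<bar> ^ 3"
      using ev
    proof eventually_elim
      case (elim n)
      then show ?case using half_h_nonzero_props(1) [OF c, of "u n"] by (simp add: step)
    qed
  qed simp
  have "(\<lambda>n. x (Suc n) + c / 4 * (sgn (x (Suc n)) / sqrt \<bar>x (Suc n)\<bar>))
      \<longlonglongrightarrow> a + c / 4 * (sgn a / sqrt \<bar>a\<bar>)"
    using a by (intro tendsto_intros x') auto
  moreover have "\<forall>\<^sub>F n in sequentially.
      x (Suc n) + c / 4 * (sgn (x (Suc n)) / sqrt \<bar>x (Suc n)\<bar>) = u n"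
    using ev
  proof eventually_elim
    case (elim n)
    then show ?case using half_h_nonzero_props(2) [OF c, of "u n"] by (simp add: step)
  qed
  ultimately have "u \<longlonglongrightarrow> a + c / 4 * (sgn a / sqrt \<bar>a\<bar>)"
    by (rule Lim_transform_eventually)
  then show "a + c / 4 * (sgn a / sqrt \<bar>a\<bar>) = b"
    using u LIMSEQ_unique by blast
qed

section \<open>Minimal singular value and Rayleigh quotient\<close>

text \<open>First-order condition at the minimum \<open>t = 0\<close>, used below to show that a
  minimizer of the Rayleigh quotient is an eigenvector.\<close>

lemma quadratic_nonneg_imp_linear_zero:
  fixes b c :: real
  assumes "\<And>t. 2 * b * t + c * t\<^sup>2 \<ge> 0"
  shows "b = 0"
proof (rule ccontr)
  assume b: "b \<noteq> 0"
  \<comment> \<open>Positive and at least \<open>c\<close> whatever the sign of \<open>c\<close>, so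
    \<open>t = - b / d\<close> makes the quadratic at most \<open>- (b\<^sup>2 / d)\<close>.\<close>
  define d where "d = \<bar>c\<bar> + 1"
  have d: "d > 0" "c \<le> d" by (auto simp: d_def)
  have "0 \<le> 2 * b * (- b / d) + c * (- b / d)\<^sup>2" by (rule assms)
  also have "\<dots> \<le> 2 * b * (- b / d) + d * (- b / d)\<^sup>2"
    using d by (intro add_left_mono mult_right_mono) auto
  also have "\<dots> = - (b\<^sup>2 / d)" using d by (simp add: field_simps power2_eq_square)
  also have "\<dots> < 0" using b d by simp
  finally show False by simp
qed

text \<open>Eigenvectors for distinct eigenvalues are orthogonal, hence independent, and a
  finite-dimensional space holds only finitely many of them.\<close>

lemma finite_symmetric_imat_eigenvalues:
  fixes M :: "'n::finite \<Rightarrow> 'n \<Rightarrow> real"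
  assumes sym: "\<And>i j. M i j = M j i"
  shows "finite {e. imat_eigenvalue S M e}"
proof -
  let ?E = "{e. imat_eigenvalue S M e}"
  \<comment> \<open>Eigenvectors are extended by zero off \<open>S\<close>, so that they live in
    \<open>real ^ 'n\<close> and their inner products are sums over \<open>S\<close>.\<close>
  define P where "P e w \<longleftrightarrow> w \<noteq> 0 \<and> supp w \<subseteq> S \<and>
    (\<forall>i\<in>S. (\<Sum>j\<in>S. M i j * w $ j) = e * w $ i)" for e and w :: "real ^ 'n"
  have ex: "\<exists>w. P e w" if "e \<in> ?E" for e
  proof -
    from that obtain v where v: "\<exists>i\<in>S. v i \<noteq> 0"
      "\<forall>i\<in>S. (\<Sum>j\<in>S. M i j * v j) = e * v i" by (auto simp: imat_eigenvalue_def)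
    have "P e (\<chi> i. if i \<in> S then v i else 0)"
      using v by (auto simp: P_def supp_def vec_eq_iff cong: sum.cong)
    then show ?thesis ..
  qed
  then obtain W where W: "\<And>e. e \<in> ?E \<Longrightarrow> P e (W e)" by metis
  have inner_S: "w \<bullet> v = (\<Sum>i\<in>S. w $ i * v $ i)" if "supp w \<subseteq> S" for w v :: "real ^ 'n"
    using that unfolding inner_vec_def
    by (intro sum.mono_neutral_cong_right) (auto simp: supp_def)
  have orth: "w \<bullet> v = 0" if w: "P e w" and v: "P f v" and "e \<noteq> f" for e f w v
  proof -
    have "e * (w \<bullet> v) = (\<Sum>i\<in>S. (\<Sum>j\<in>S. M i j * w $ j) * v $ i)"
      using w by (simp add: P_def inner_S sum_distrib_left mult.assoc)
    also have "\<dots> = (\<Sum>i\<in>S. \<Sum>j\<in>S. M i j * w $ j * v $ i)" by (simp add: sum_distrib_right)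
    also have "\<dots> = (\<Sum>j\<in>S. \<Sum>i\<in>S. M i j * w $ j * v $ i)" by (rule sum.swap)
    also have "\<dots> = (\<Sum>j\<in>S. w $ j * (\<Sum>i\<in>S. M j i * v $ i))"
      by (simp add: sum_distrib_left mult_ac sym)
    also have "\<dots> = f * (w \<bullet> v)"
      using w v by (simp add: P_def inner_S sum_distrib_left mult_ac)
    finally show ?thesis using \<open>e \<noteq> f\<close> by simp
  qed
  have inj: "inj_on W ?E"
  proof (rule inj_onI)
    fix e f assume ef: "e \<in> ?E" "f \<in> ?E" "W e = W f"
    show "e = f"
      using orth [OF W [OF ef(1)] W [OF ef(2)]] W [OF ef(1)] ef(3) by (auto simp: P_def)
  qed
  have "pairwise orthogonal (W ` ?E)"
    unfolding pairwise_def orthogonal_def using orth W by blast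
  then have "independent (W ` ?E)"
    by (rule pairwise_orthogonal_independent) (use W in \<open>auto simp: P_def\<close>)
  then have "finite (W ` ?E)" by (rule independent_imp_finite)
  then show ?thesis using inj by (rule finite_imageD)
qed

text \<open>The Rayleigh quotient attains its minimum \<open>e\<close> on vectors supported in
  \<open>S\<close>. The minimizer is an eigenvector of the Gram matrix, so \<open>e\<close> is one
  of its singular values and \<open>sigma_min\<close> is at most \<open>e\<close>.\<close>

lemma sigma_min_gram_le_quotient:
  fixes A :: "real ^ 'n ^ 'm"
  assumes S: "S \<noteq> {}" and v: "supp v \<subseteq> S"
  shows "sigma_min S (gram_submatrix A S) * (norm v)\<^sup>2 \<le> (norm (A *v v))\<^sup>2"
proof -
  define V where "V = {v :: real ^ 'n. supp v \<subseteq> S}"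
  define K where "K = V \<inter> sphere 0 1"
  have V_eq: "V = (\<Inter>i\<in>-S. {v. v $ i = 0})" by (auto simp: V_def supp_def)
  have "closed V" unfolding V_eq
    by (intro closed_INT ballI closed_Collect_eq continuous_intros)
  then have cK: "compact K" unfolding K_def by (intro closed_Int_compact compact_sphere)
  have axV: "axis i 1 \<in> V" if "i \<in> S" for i
    using that by (auto simp: V_def supp_def axis_def)
  obtain i0 where i0: "i0 \<in> S" using S by auto
  then have "axis i0 1 \<in> K" using axV by (simp add: K_def)
  then have "K \<noteq> {}" by auto
  moreover have "continuous_on K (\<lambda>v. (norm (A *v v))\<^sup>2)"
    by (intro continuous_intros linear_continuous_on matrix_vector_mul_bounded_linear)
  ultimately obtain w where w: "w \<in> K" "\<And>v. v \<in> K \<Longrightarrow> (norm (A *v w))\<^sup>2 \<le> (norm (A *v v))\<^sup>2"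
    using continuous_attains_inf [OF cK] by metis
  define e where "e = (norm (A *v w))\<^sup>2"
  have e0: "e \<ge> 0" by (simp add: e_def)
  have wV: "w \<in> V" and nw: "norm w = 1" using w by (auto simp: K_def)
  have V_lin: "a *\<^sub>R p + b *\<^sub>R q \<in> V" if "p \<in> V" "q \<in> V" for a b p q
    using that by (auto simp: V_eq)
  have low: "e * (norm p)\<^sup>2 \<le> (norm (A *v p))\<^sup>2" if "p \<in> V" for p
  proof (cases "p = 0")
    case False
    define r where "r = (1 / norm p) *\<^sub>R p"
    have "r \<in> K" using that False V_lin [of p p "1 / norm p" 0] by (auto simp: K_def r_def)
    then have "e \<le> (norm (A *v r))\<^sup>2" using w(2) by (simp add: e_def)
    also have "\<dots> = (norm (A *v p))\<^sup>2 / (norm p)\<^sup>2"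
      by (simp add: r_def matrix_vector_mult_scaleR power_divide)
    finally show ?thesis using False by (simp add: field_simps)
  qed simp
  \<comment> \<open>Along \<open>w + t *\<^sub>R p\<close> the difference of the two sides of
    \<open>low\<close> is a nonnegative quadratic in \<open>t\<close> vanishing at 0, so its linear
    coefficient is zero.\<close>
  have crit: "(A *v w) \<bullet> (A *v p) = e * (w \<bullet> p)" if "p \<in> V" for p
  proof -
    have "2 * ((A *v w) \<bullet> (A *v p) - e * (w \<bullet> p)) * t
        + ((norm (A *v p))\<^sup>2 - e * (norm p)\<^sup>2) * t\<^sup>2 \<ge> 0" for t
    proof -
      have "w + t *\<^sub>R p \<in> V" using V_lin [OF wV that, of 1 t] by simp
      from low [OF this] have "e * (norm (w + t *\<^sub>R p))\<^sup>2 \<le> (norm (A *v w + t *\<^sub>R (A *v p)))\<^sup>2"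
        by (simp add: matrix_vector_right_distrib matrix_vector_mult_scaleR)
      moreover have "w \<bullet> w = 1" using nw by (simp add: norm_eq_1)
      moreover have "(A *v w) \<bullet> (A *v w) = e" by (simp add: e_def power2_norm_eq_inner)
      ultimately show ?thesis
        unfolding power2_norm_eq_inner
        by (simp add: inner_add inner_commute algebra_simps power2_eq_square)
    qed
    from quadratic_nonneg_imp_linear_zero [OF this] show ?thesis by simp
  qed
  let ?G = "gram_submatrix A S"
  have Gsym: "?G i j = ?G j i" for i j
    by (simp add: gram_submatrix_def imat_mult_def imat_transpose_def mult.commute)
  have Gw: "(\<Sum>j\<in>S. ?G i j * w $ j) = e * w $ i" if i: "i \<in> S" for i
  proof -
    have col: "(A *v w) $ k = (\<Sum>j\<in>S. A $ k $ j * w $ j)" for k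
      using wV unfolding matrix_vector_mult_def
      by (auto simp: V_def supp_def intro!: sum.mono_neutral_right)
    have "(\<Sum>j\<in>S. ?G i j * w $ j) = (\<Sum>j\<in>S. \<Sum>k\<in>UNIV. A $ k $ i * A $ k $ j * w $ j)"
      using i by (simp add: gram_submatrix_def imat_mult_def imat_transpose_def
          column_submatrix_def sum_distrib_right)
    also have "\<dots> = (\<Sum>k\<in>UNIV. \<Sum>j\<in>S. A $ k $ i * A $ k $ j * w $ j)" by (rule sum.swap)
    also have "\<dots> = (\<Sum>k\<in>UNIV. (A *v w) $ k * A $ k $ i)"
      by (simp add: col sum_distrib_left sum_distrib_right mult_ac)
    also have "\<dots> = (A *v w) \<bullet> (A *v axis i 1)"
      by (simp add: inner_vec_def matrix_vector_mult_basis column_def)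
    also have "\<dots> = e * w $ i" using crit [OF axV [OF i]] by (simp add: inner_axis)
    finally show ?thesis .
  qed
  \<comment> \<open>Singular values are square roots of eigenvalues of this product, for which
    \<open>w\<close> has eigenvalue \<open>e\<^sup>2\<close>; \<open>e \<ge> 0\<close> lets the root
    return \<open>e\<close>.\<close>
  let ?M = "imat_mult S (imat_transpose ?G) ?G"
  have "(\<Sum>j\<in>S. ?M i j * w $ j) = e\<^sup>2 * w $ i" if i: "i \<in> S" for i
  proof -
    have "(\<Sum>j\<in>S. ?M i j * w $ j) = (\<Sum>j\<in>S. \<Sum>k\<in>S. ?G k i * ?G k j * w $ j)"
      by (simp add: imat_mult_def imat_transpose_def sum_distrib_right)
    also have "\<dots> = (\<Sum>k\<in>S. \<Sum>j\<in>S. ?G k i * ?G k j * w $ j)" by (rule sum.swap)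
    also have "\<dots> = (\<Sum>k\<in>S. ?G k i * (\<Sum>j\<in>S. ?G k j * w $ j))"
      by (simp add: sum_distrib_left mult.assoc)
    also have "\<dots> = (\<Sum>k\<in>S. ?G i k * (e * w $ k))"
      by (intro sum.cong) (simp_all add: Gw Gsym [of _ i])
    also have "\<dots> = e * (\<Sum>k\<in>S. ?G i k * w $ k)"
      by (simp add: sum_distrib_left mult_ac)
    finally show ?thesis using i by (simp add: Gw power2_eq_square)
  qed
  moreover have "\<exists>i\<in>S. w $ i \<noteq> 0"
  proof (rule ccontr)
    assume "\<not> ?thesis"
    then have "w = 0" using wV by (auto simp: V_def supp_def vec_eq_iff)
    then show False using nw by simp
  qed
  ultimately have "imat_eigenvalue S ?M (e\<^sup>2)" unfolding imat_eigenvalue_def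
    by (intro exI [of _ "\<lambda>i. w $ i"]) auto
  then have "sqrt (e\<^sup>2) \<in> imat_singular_values S ?G"
    unfolding imat_singular_values_def by blast
  then have mem: "e \<in> imat_singular_values S ?G" using e0 by simp
  have "finite {f. imat_eigenvalue S ?M f}"
    by (rule finite_symmetric_imat_eigenvalues)
      (simp add: imat_mult_def imat_transpose_def mult.commute)
  then have "finite (imat_singular_values S ?G)"
    unfolding imat_singular_values_def by (simp add: setcompr_eq_image)
  then have "sigma_min S ?G \<le> e" unfolding sigma_min_def using mem by (rule Min_le)
  then have "sigma_min S ?G * (norm v)\<^sup>2 \<le> e * (norm v)\<^sup>2" by (rule mult_right_mono) simp
  also have "\<dots> \<le> (norm (A *v v))\<^sup>2" using low v by (simp add: V_def)
  finally show ?thesis .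
qed

section \<open>Local estimates for the square root penalty\<close>

text \<open>The second-order Taylor coefficient has modulus 1/8 over
  \<open>sqrt (\<bar>a\<bar> ^ 3)\<close>; any larger \<open>\<kappa>\<close> absorbs the remainder.
  With \<open>b\<close> and \<open>s\<close> the two roots, the error of the linear term is exactly
  \<open>(s - b)\<^sup>2 / (2 * b)\<close>.\<close>

lemma sqrt_abs_quadratic_lower_bound:
  fixes a \<kappa> :: real
  assumes a: "a \<noteq> 0" and \<kappa>: "\<kappa> > 1 / 8"
  shows "\<forall>\<^sub>F t in nhds 0. sgn a / (2 * sqrt \<bar>a\<bar>) * t - \<kappa> * t\<^sup>2 / sqrt (\<bar>a\<bar> ^ 3)
    \<le> sqrt (\<bar>a + t\<bar>) - sqrt (\<bar>a\<bar>)"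
proof -
  define b where "b = sqrt \<bar>a\<bar>"
  have b: "b > 0" "b\<^sup>2 = \<bar>a\<bar>" using a by (auto simp: b_def)
  have b3: "sqrt (\<bar>a\<bar> ^ 3) = b ^ 3" by (simp add: b_def real_sqrt_power)
  have "((\<lambda>t. \<kappa> * (sqrt \<bar>a + t\<bar> + b)\<^sup>2) \<longlongrightarrow> \<kappa> * (sqrt \<bar>a + 0\<bar> + b)\<^sup>2) (nhds 0)"
    by (intro tendsto_intros filterlim_ident)
  then have lim: "((\<lambda>t. \<kappa> * (sqrt \<bar>a + t\<bar> + b)\<^sup>2) \<longlongrightarrow> \<kappa> * (2 * b)\<^sup>2) (nhds 0)"
    by (simp add: b_def)
  \<comment> \<open>At \<open>t = 0\<close> the sum of the roots is \<open>2 * b\<close>, and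
    \<open>\<kappa> > 1 / 8\<close> makes the required inequality strict there, so it persists
    nearby.\<close>
  have "b\<^sup>2 * (1 / 8) < b\<^sup>2 * \<kappa>" using \<kappa> b by (intro mult_strict_left_mono) auto
  then have "b\<^sup>2 / 2 < \<kappa> * (2 * b)\<^sup>2" by (simp add: power_mult_distrib mult_ac)
  then have ev1: "\<forall>\<^sub>F t in nhds 0. b\<^sup>2 / 2 < \<kappa> * (sqrt \<bar>a + t\<bar> + b)\<^sup>2"
    using lim by (rule order_tendstoD(1) [rotated])
  \<comment> \<open>Keeps \<open>a + t\<close> on the same side of zero as \<open>a\<close>.\<close>
  have ev2: "\<forall>\<^sub>F t in nhds (0::real). \<bar>t\<bar> < \<bar>a\<bar>"
    using a by (auto simp: eventually_nhds_metric intro!: exI [of _ "\<bar>a\<bar>"])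
  from ev1 ev2 show ?thesis
  proof eventually_elim
    case (elim t)
    define s where "s = sqrt \<bar>a + t\<bar>"
    have at: "\<bar>a + t\<bar> = \<bar>a\<bar> + sgn a * t" using elim(2) by (auto simp: sgn_if)
    have s2: "s\<^sup>2 = b\<^sup>2 + sgn a * t" by (simp add: s_def b at [symmetric])
    then have st: "sgn a * t = s\<^sup>2 - b\<^sup>2" by simp
    have "t\<^sup>2 = (sgn a * t)\<^sup>2" using a by (auto simp: sgn_if)
    then have t2: "t\<^sup>2 = (s - b)\<^sup>2 * (s + b)\<^sup>2"
      unfolding st by (simp add: power2_eq_square algebra_simps)
    have "(s - b)\<^sup>2 * (b\<^sup>2 / 2) \<le> (s - b)\<^sup>2 * (\<kappa> * (s + b)\<^sup>2)"
      using elim(1) by (intro mult_left_mono) (auto simp: s_def)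
    then have "(s - b)\<^sup>2 * (b\<^sup>2 / 2) / b ^ 3 \<le> \<kappa> * t\<^sup>2 / b ^ 3"
      using b by (intro divide_right_mono) (auto simp: t2 mult_ac)
    moreover have "(s - b)\<^sup>2 * (b\<^sup>2 / 2) / b ^ 3 = (s - b)\<^sup>2 / (2 * b)"
      using a b(1) by (simp add: power2_eq_square power3_eq_cube)
    moreover have "(sgn a * t) / (2 * b) - (s - b)\<^sup>2 / (2 * b) = s - b"
      unfolding st using b by (simp add: field_simps power2_eq_square)
    ultimately show ?case unfolding b3 b_def [symmetric] s_def [symmetric] by simp
  qed
qed

lemma linear_le_sqrt:
  fixes C l :: real
  assumes l: "l > 0"
  shows "\<forall>\<^sub>F t in nhds 0. C * \<bar>t\<bar> \<le> l * sqrt \<bar>t\<bar>"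
proof -
  have "((\<lambda>t. C * sqrt \<bar>t\<bar>) \<longlongrightarrow> C * sqrt \<bar>0\<bar>) (nhds 0)"
    by (intro tendsto_intros filterlim_ident)
  then have "((\<lambda>t. C * sqrt \<bar>t\<bar>) \<longlongrightarrow> 0) (nhds 0)" by simp
  then have "\<forall>\<^sub>F t in nhds 0. C * sqrt \<bar>t\<bar> < l" using l by (rule order_tendstoD)
  then show ?thesis
  proof eventually_elim
    case (elim t)
    then have "C * sqrt \<bar>t\<bar> * sqrt \<bar>t\<bar> \<le> l * sqrt \<bar>t\<bar>" by (intro mult_right_mono) auto
    then show ?case by (simp add: mult.assoc)
  qed
qed

section \<open>Sufficient conditions for a local minimizer\<close>

lemma T_half_sqrt:
  "T_half A y lam x = (norm (A *v x - y))\<^sup>2 + lam * (\<Sum>i\<in>UNIV. sqrt \<bar>x $ i\<bar>)"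
  by (simp add: T_half_def powr_half_sqrt)

text \<open>A displacement \<open>h\<close> splits into \<open>p\<close> on the support and
  \<open>q\<close> off it. For \<open>p\<close>, stationarity cancels the linear terms and
  coercivity outweighs the concavity of the root; for \<open>q\<close>, all losses are linear and
  the root absorbs them.\<close>

lemma local_minimizer_T_half_sufficient:
  fixes A :: "real ^ 'n ^ 'm" and xs :: "real ^ 'n"
  assumes lam: "lam > 0"
    and coercive: "\<And>p. supp p \<subseteq> supp xs \<Longrightarrow> \<sigma> * (norm p)\<^sup>2 \<le> (norm (A *v p))\<^sup>2"
    and stationary: "\<And>i. xs $ i \<noteq> 0 \<Longrightarrow>
      (transpose A *v (A *v xs - y)) $ i = - (lam / 4) * (sgn (xs $ i) / sqrt \<bar>xs $ i\<bar>)"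
    and curvature: "\<And>i. xs $ i \<noteq> 0 \<Longrightarrow> lam / (8 * sqrt (\<bar>xs $ i\<bar> ^ 3)) < \<sigma>"
  shows "local_minimizer (T_half A y lam) xs"
proof -
  define g where "g = transpose A *v (A *v xs - y)"
  define B where "B = onorm (\<lambda>v. A *v v)"
  have B: "norm (A *v v) \<le> B * norm v" for v
    unfolding B_def by (rule onorm) (rule matrix_vector_mul_bounded_linear)
  have B0: "B \<ge> 0" unfolding B_def by (rule onorm_pos_le) (rule matrix_vector_mul_bounded_linear)
  \<comment> \<open>Collects the losses linear in \<open>q\<close>: \<open>2 * norm g\<close> from
    the gradient, \<open>2 * B\<^sup>2\<close> from the cross term of \<open>p\<close> and
    \<open>q\<close> when \<open>norm p \<le> 1\<close>.\<close>
  define C where "C = 2 * norm g + 2 * B\<^sup>2"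
  define good where "good i t \<longleftrightarrow> (if xs $ i = 0 then C * \<bar>t\<bar> \<le> lam * sqrt \<bar>t\<bar>
     else lam * (sqrt (\<bar>xs $ i + t\<bar>) - sqrt (\<bar>xs $ i\<bar>)) \<ge> - 2 * g $ i * t - \<sigma> * t\<^sup>2)" for i t
  have good_ev: "\<forall>\<^sub>F t in nhds 0. good i t" for i
  proof (cases "xs $ i = 0")
    case True
    then show ?thesis using linear_le_sqrt [OF lam, of C] by (simp add: good_def)
  next
    case False
    define d where "d = sqrt (\<bar>xs $ i\<bar> ^ 3)"
    have d: "d > 0" using False by (simp add: d_def)
    \<comment> \<open>Chosen so that \<open>lam * \<kappa> / d = \<sigma>\<close>; the curvature
      hypothesis then says \<open>\<kappa> > 1 / 8\<close>.\<close>
    define \<kappa> where "\<kappa> = \<sigma> * d / lam"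
    have "\<kappa> > 1 / 8" using curvature [OF False] d lam
      by (simp add: \<kappa>_def d_def [symmetric] field_simps)
    from sqrt_abs_quadratic_lower_bound [OF False this] show ?thesis
    proof eventually_elim
      case (elim t)
      have "lam * (sgn (xs $ i) / (2 * sqrt \<bar>xs $ i\<bar>) * t - \<kappa> * t\<^sup>2 / d)
         \<le> lam * (sqrt (\<bar>xs $ i + t\<bar>) - sqrt (\<bar>xs $ i\<bar>))"
        using elim lam by (intro mult_left_mono) (auto simp: d_def)
      moreover have "lam * (\<kappa> * t\<^sup>2 / d) = \<sigma> * t\<^sup>2"
        using d lam by (simp add: \<kappa>_def)
      moreover have "lam * (sgn (xs $ i) / (2 * sqrt \<bar>xs $ i\<bar>) * t) = - 2 * g $ i * t"
        using stationary [OF False] by (simp add: g_def)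
      ultimately show ?case using False by (simp add: good_def right_diff_distrib)
    qed
  qed
  have "\<exists>r>0. \<forall>t. \<bar>t\<bar> < r \<longrightarrow> good i t" for i
    using good_ev [of i] by (auto simp: eventually_nhds_metric)
  then obtain r where r: "\<And>i. r i > 0" "\<And>i t. \<bar>t\<bar> < r i \<Longrightarrow> good i t" by metis
  \<comment> \<open>The cap 1 yields \<open>norm p \<le> 1\<close>, which makes the cross term
    linear in \<open>q\<close>.\<close>
  define R where "R = min 1 (Min (range r))"
  have R0: "R > 0" using r(1) by (auto simp: R_def)
  have Rr: "R \<le> r i" for i unfolding R_def by (rule min.coboundedI2) simp
  show ?thesis unfolding local_minimizer_def
  proof (intro exI conjI ballI)
    fix z assume z: "z \<in> ball xs R"
    define h where "h = z - xs"
    have nh: "norm h < R" using z by (simp add: h_def dist_norm norm_minus_commute)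
    have goodh: "good i (h $ i)" for i
      using component_le_norm_cart [of h i] nh Rr [of i] by (intro r) linarith
    define p where "p = (\<chi> i. if xs $ i = 0 then 0 else h $ i)"
    define q where "q = (\<chi> i. if xs $ i = 0 then h $ i else 0)"
    have hpq: "h = p + q" by (simp add: p_def q_def vec_eq_iff)
    have "norm p \<le> norm h" by (rule norm_le_componentwise_cart) (simp add: p_def)
    then have np: "norm p \<le> 1" using nh by (simp add: R_def)
    have pp: "\<sigma> * (norm p)\<^sup>2 \<le> (norm (A *v p))\<^sup>2"
      by (rule coercive) (auto simp: supp_def p_def)
    have cross: "(A *v p) \<bullet> (A *v q) \<ge> - (B\<^sup>2 * norm q)"
    proof -
      have "\<bar>(A *v p) \<bullet> (A *v q)\<bar> \<le> norm (A *v p) * norm (A *v q)"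
        by (rule Cauchy_Schwarz_ineq2)
      also have "\<dots> \<le> (B * norm p) * (B * norm q)"
        using B0 by (intro mult_mono B) auto
      also have "\<dots> = norm p * (B\<^sup>2 * norm q)" by (simp add: power2_eq_square)
      also have "\<dots> \<le> 1 * (B\<^sup>2 * norm q)" using np by (intro mult_right_mono) auto
      finally show ?thesis by linarith
    qed
    have gh: "(A *v xs - y) \<bullet> (A *v h) = g \<bullet> h"
      by (simp add: g_def dot_lmul_matrix [symmetric])
    have quad: "(norm (A *v z - y))\<^sup>2 = (norm (A *v xs - y))\<^sup>2 + 2 * (g \<bullet> h) + (norm (A *v h))\<^sup>2"
    proof -
      have Az: "A *v z - y = (A *v xs - y) + A *v h"
        by (simp add: h_def matrix_vector_mult_diff_distrib)
      show ?thesis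
        unfolding Az by (simp add: power2_norm_eq_inner inner_add inner_commute gh [symmetric])
    qed
    have Ah: "(norm (A *v h))\<^sup>2 \<ge> \<sigma> * (norm p)\<^sup>2 - 2 * B\<^sup>2 * norm q"
    proof -
      have "(norm (A *v h))\<^sup>2 = (norm (A *v p))\<^sup>2 + 2 * ((A *v p) \<bullet> (A *v q)) + (norm (A *v q))\<^sup>2"
        by (simp add: hpq matrix_vector_right_distrib power2_norm_eq_inner inner_add inner_commute)
      then show ?thesis using pp cross zero_le_power2 [of "norm (A *v q)"] by linarith
    qed
    have gq: "2 * (g \<bullet> h) \<ge> 2 * (g \<bullet> p) - 2 * norm g * norm q"
      using Cauchy_Schwarz_ineq2 [of g q] by (simp add: hpq inner_add_right)
    \<comment> \<open>Passing to the sum of absolute values makes the bound separate into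
      coordinates, where \<open>good\<close> applies.\<close>
    have "2 * (g \<bullet> p) + \<sigma> * (norm p)\<^sup>2 - C * norm q
        \<ge> 2 * (g \<bullet> p) + \<sigma> * (norm p)\<^sup>2 - C * (\<Sum>i\<in>UNIV. \<bar>q $ i\<bar>)"
      by (intro diff_left_mono mult_left_mono norm_le_l1_cart) (simp add: C_def)
    moreover have "2 * (g \<bullet> p) + \<sigma> * (norm p)\<^sup>2 - C * (\<Sum>i\<in>UNIV. \<bar>q $ i\<bar>)
        = (\<Sum>i\<in>UNIV. 2 * g $ i * p $ i + \<sigma> * (p $ i)\<^sup>2 - C * \<bar>q $ i\<bar>)"
      unfolding power2_norm_eq_inner
      by (simp add: inner_vec_def sum_subtractf sum.distrib
          sum_distrib_left power2_eq_square mult.assoc)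
    moreover have "\<dots> \<ge> (\<Sum>i\<in>UNIV. - (lam * (sqrt (\<bar>z $ i\<bar>) - sqrt (\<bar>xs $ i\<bar>))))"
    proof (rule sum_mono)
      fix i
      show "- (lam * (sqrt (\<bar>z $ i\<bar>) - sqrt (\<bar>xs $ i\<bar>)))
          \<le> 2 * g $ i * p $ i + \<sigma> * (p $ i)\<^sup>2 - C * \<bar>q $ i\<bar>"
        using goodh [of i] by (auto simp: good_def p_def q_def h_def split: if_splits)
    qed
    moreover have "(\<Sum>i\<in>UNIV. - (lam * (sqrt (\<bar>z $ i\<bar>) - sqrt (\<bar>xs $ i\<bar>))))
        = lam * (\<Sum>i\<in>UNIV. sqrt \<bar>xs $ i\<bar>) - lam * (\<Sum>i\<in>UNIV. sqrt \<bar>z $ i\<bar>)"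
      by (simp add: sum_subtractf sum_distrib_left right_diff_distrib)
    moreover have "C * norm q = 2 * norm g * norm q + 2 * B\<^sup>2 * norm q"
      by (simp add: C_def distrib_right)
    ultimately show "T_half A y lam xs \<le> T_half A y lam z"
      unfolding T_half_sqrt quad using Ah gq by linarith
  qed (rule R0)
qed

section \<open>Limits of the half algorithm\<close>

theorem theorem2:
  fixes A :: "real ^ 'n ^ 'm"
    and y :: "real ^ 'm"
    and lam mu :: real
    and x :: "nat \<Rightarrow> real ^ 'n"
    and xs :: "real ^ 'n"
  assumes "lam > 0"
    and "mu > 0"
    and "\<And>n. x (Suc n) = half_H (lam * mu) (x n - mu *\<^sub>R (transpose A *v (A *v x n - y)))"
    and "x \<longlonglongrightarrow> xs"
    and "supp xs \<noteq> {}"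
    and "sigma_min (supp xs) (gram_submatrix A (supp xs)) > (spectral_norm A)\<^sup>2 / 4"
    and "1 / (4 * sigma_min (supp xs) (gram_submatrix A (supp xs))) < mu"
    and "mu < 1 / (spectral_norm A)\<^sup>2"
  shows "local_minimizer (T_half A y lam) xs"
proof -
  let ?\<sigma> = "sigma_min (supp xs) (gram_submatrix A (supp xs))"
  define grad where "grad v = transpose A *v (A *v v - y)" for v
  define c where "c = lam * mu"
  have c: "c > 0" using assms(1,2) by (simp add: c_def)
  \<comment> \<open>Positivity is what allows the lower bound on \<open>mu\<close> to be rearranged
    into \<open>1 / (4 * mu) < ?\<sigma>\<close>.\<close>
  have \<sigma>0: "?\<sigma> > 0" using assms(6) zero_le_power2 [of "spectral_norm A"] by linarith
  have lim: "\<bar>xs $ i\<bar> ^ 3 \<ge> c\<^sup>2 / 4 \<and>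
      xs $ i + c / 4 * (sgn (xs $ i) / sqrt \<bar>xs $ i\<bar>) = (xs - mu *\<^sub>R grad xs) $ i"
    if "xs $ i \<noteq> 0" for i
  proof -
    have "(\<lambda>n. x n - mu *\<^sub>R grad (x n)) \<longlonglongrightarrow> xs - mu *\<^sub>R grad xs"
      unfolding grad_def
      by (intro tendsto_intros assms(4)
          bounded_linear.tendsto [OF matrix_vector_mul_bounded_linear])
    then have u: "(\<lambda>n. (x n - mu *\<^sub>R grad (x n)) $ i) \<longlonglongrightarrow> (xs - mu *\<^sub>R grad xs) $ i"
      by (rule tendsto_vec_nth)
    have "x (Suc n) $ i = half_h c ((x n - mu *\<^sub>R grad (x n)) $ i)" for n
      unfolding assms(3) [of n] by (simp add: half_H_def c_def grad_def)
    from half_h_limit_props [OF c tendsto_vec_nth [OF assms(4)] u this that]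
    show ?thesis by blast
  qed
  show ?thesis
  proof (rule local_minimizer_T_half_sufficient [OF assms(1)])
    show "?\<sigma> * (norm p)\<^sup>2 \<le> (norm (A *v p))\<^sup>2" if "supp p \<subseteq> supp xs" for p
      using assms(5) that by (rule sigma_min_gram_le_quotient)
    fix i assume i: "xs $ i \<noteq> 0"
    \<comment> \<open>\<open>xs $ i\<close> cancels from the limit equation, and
      \<open>c = lam * mu\<close> supplies the common factor \<open>mu\<close>.\<close>
    have "mu * grad xs $ i = mu * (- (lam / 4) * (sgn (xs $ i) / sqrt \<bar>xs $ i\<bar>))"
      using lim [OF i] by (simp add: c_def algebra_simps)
    then have "grad xs $ i = - (lam / 4) * (sgn (xs $ i) / sqrt \<bar>xs $ i\<bar>)"
      using assms(2) by (simp only: mult_cancel_left) simp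
    then show "(transpose A *v (A *v xs - y)) $ i = - (lam / 4) * (sgn (xs $ i) / sqrt \<bar>xs $ i\<bar>)"
      by (simp add: grad_def)
    \<comment> \<open>The magnitude bound gives curvature at most \<open>lam / (4 * c)\<close>,
      which is \<open>1 / (4 * mu)\<close>.\<close>
    have "(c / 2)\<^sup>2 \<le> \<bar>xs $ i\<bar> ^ 3" using lim [OF i] by (simp add: power_divide)
    then have "c / 2 \<le> sqrt (\<bar>xs $ i\<bar> ^ 3)" by (rule real_le_rsqrt)
    then have "lam / (8 * sqrt (\<bar>xs $ i\<bar> ^ 3)) \<le> lam / (8 * (c / 2))"
      using assms(1) c by (intro divide_left_mono mult_left_mono mult_pos_pos) auto
    also have "\<dots> = 1 / (4 * mu)" using assms(1,2) by (simp add: c_def)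
    also have "\<dots> < ?\<sigma>" using assms(2,7) \<sigma>0 by (simp add: field_simps)
    finally show "lam / (8 * sqrt (\<bar>xs $ i\<bar> ^ 3)) < ?\<sigma>" .
  qed
qed

end
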